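(* Let $n,m\ge 1$ and $0\le t<T$ be integers, let $\sigma(s)=\max(s,0)$ be the ReLU function applied coordinatewise to vectors, let $\mathbf{W}_k\in\mathbb{R}^{n\times n}$ be orthogonal matrices and $\mathbf{V}_k\in\mathbb{R}^{n\times m}$ arbitrary matrices for $k=t,\dots,T-1$, let $x_{t+1},\dots,x_T\in\mathbb{R}^m$ be fixed inputs, and let $h_t\in\mathbb{R}^n$. Define, for $k=t,\dots,T-1$, $$z_{k+1}=\mathbf{W}_k h_k+\mathbf{V}_k x_{k+1},\qquad h_{k+1}=\sigma(z_{k+1}).$$ Assume that no coordinate $z_{k+1}^{(j)}$ ($t\le k\le T-1$, $1\le j\le n$) equals $0$, and that for every $k\in\{t,\dots,T-1\}$ at least one coordinate of $z_{k+1}$ is positive (the activations are not all killed at any layer). Let $C:\mathbb{R}^n\to\mathbb{R}$ be an objective, viewed as a function of $h_T$, that is differentiable at $h_T$. Put $\mathbf{D}_{k+1}=\mathrm{diag}\big(\sigma'(z_{k+1}^{(1)}),\dots,\sigma'(z_{k+1}^{(n)})\big)$. Then $$\left\|\frac{\partial C}{\partial h_t}\right\|\le\left\|\frac{\partial C}{\partial h_T}\right\|\prod_{k=t}^{T-1}\|\mathbf{D}_{k+1}\|=\left\|\frac{\partial C}{\partial h_T}\right\|.$$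
   Context: The norm of a vector is the Euclidean ($L_2$) norm and the norm of a matrix is the operator norm induced by it. A real square matrix $\mathbf{W}$ is orthogonal if $\mathbf{W}^\top\mathbf{W}=\mathbf{W}\mathbf{W}^\top=\mathbf{I}$. $\frac{\partial C}{\partial h_T}$ is the gradient of $C$ at $h_T$, and $\frac{\partial C}{\partial h_t}$ is the gradient, at the given $h_t$, of the composite map sending $h_t$ to $C(h_T)$ through the recursion, with all $\mathbf{W}_k,\mathbf{V}_k,x_{k+1}$ held fixed. *)

theory Defs
  imports "HOL-Analysis.Analysis"
begin

definition relu :: "real \<Rightarrow> real" where
  "relu s = max s 0"

definition relu_vec :: "real ^ 'n \<Rightarrow> real ^ 'n" where
  "relu_vec v = (\<chi> i. relu (v $ i))"

definition diag_matrix :: "real ^ 'n \<Rightarrow> real ^ 'n ^ 'n" where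
  "diag_matrix d = (\<chi> i j. if i = j then d $ i else 0)"

text \<open>The library's \<open>norm\<close> on \<open>real ^ 'n ^ 'm\<close> is the Frobenius norm, not the operator norm.\<close>

definition matrix_opnorm :: "real ^ 'n ^ 'm \<Rightarrow> real" where
  "matrix_opnorm A = onorm (\<lambda>v. A *v v)"

text \<open>Only meaningful where \<open>f\<close> is differentiable; elsewhere the value is unspecified.\<close>

definition gradient :: "(real ^ 'n \<Rightarrow> real) \<Rightarrow> real ^ 'n \<Rightarrow> real ^ 'n" where
  "gradient f a = (THE D. GDERIV f a :> D)"

lemma gradient_eqI:
  assumes "GDERIV f a :> D"
  shows "gradient f a = D"
  unfolding gradient_def
proof (rule the_equality)
  show "GDERIV f a :> D" by (fact assms)
next
  fix E assume "GDERIV f a :> E"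
  then have "(\<lambda>v. inner v E) = (\<lambda>v. inner v D)"
    using assms unfolding gderiv_def by (rule has_derivative_unique)
  then show "E = D"
    by (metis vector_eq_ldot)
qed

text \<open>
  \<open>rnn_state W V x t u k\<close> is the hidden state at time \<open>k\<close> when the recursion is started at
  time \<open>t\<close> in state \<open>u\<close>; for \<open>k \<le> t\<close> it is \<open>u\<close>.
\<close>

primrec rnn_state ::
  "(nat \<Rightarrow> real ^ 'n ^ 'n) \<Rightarrow> (nat \<Rightarrow> real ^ 'm ^ 'n) \<Rightarrow> (nat \<Rightarrow> real ^ 'm) \<Rightarrow> nat
    \<Rightarrow> real ^ 'n \<Rightarrow> nat \<Rightarrow> real ^ 'n" where
  "rnn_state W V x t u 0 = u"
| "rnn_state W V x t u (Suc k) =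
     (if t \<le> k
      then relu_vec (W k *v rnn_state W V x t u k + V k *v x (Suc k))
      else u)"

end

(* Away from the kinks each layer is differentiable with derivative D W, where D is a 0/1 diagonal
   matrix and W an isometry, hence a contraction. So the derivative L of the whole recursion is
   a contraction; for the gradients p of the composite and q of C one has
   |p|^2 = L p . q <= |p| |q|. A positive pre-activation puts a 1 on the diagonal of D, so that
   every factor |D| is exactly 1. *)
theory Submission
  imports Defs
begin

text \<open>Away from the kink \<open>relu\<close> coincides, on a whole open half-line around
  \<open>s\<close>, with the identity or with the zero function.\<close>

lemma relu_has_real_derivative:
  assumes "s \<noteq> 0"
  shows "(relu has_real_derivative (if s > 0 then 1 else 0)) (at s)"
proof (cases "s > 0")
  case True
  have "(relu has_real_derivative 1) (at s)"
    by (rule has_field_derivative_transform_within_open[OF DERIV_ident, where S = "{0<..}"])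
      (use True in \<open>auto simp: relu_def\<close>)
  then show ?thesis using True by simp
next
  case False
  have "(relu has_real_derivative 0) (at s)"
    by (rule has_field_derivative_transform_within_open[OF DERIV_const, where S = "{..<0}"])
      (use False assms in \<open>auto simp: relu_def\<close>)
  then show ?thesis using False by simp
qed

lemma deriv_relu:
  assumes "s \<noteq> 0"
  shows "deriv relu s = (if s > 0 then 1 else 0)"
  using relu_has_real_derivative[OF assms] by (rule DERIV_imp_deriv)

lemma diag_matrix_mult_component [simp]:
  "(diag_matrix d *v v) $ i = d $ i * v $ i"
  by (simp add: diag_matrix_def matrix_vector_mult_def if_distrib[of "\<lambda>a. a * _"] cong: if_cong)

lemma norm_diag_matrix_mult_le:
  fixes d v :: "real ^ 'n"
  assumes "\<And>i. \<bar>d $ i\<bar> \<le> 1"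
  shows "norm (diag_matrix d *v v) \<le> norm v"
proof (rule norm_le_componentwise_cart)
  show "norm ((diag_matrix d *v v) $ i) \<le> norm (v $ i)" for i
    using mult_right_mono[OF assms[of i], of "\<bar>v $ i\<bar>"] by (simp add: abs_mult)
qed

text \<open>Entries bounded by 1 make the matrix a contraction, and the unit vector
  \<open>axis j 1\<close> is fixed by it, so the bound 1 is attained.\<close>

lemma matrix_opnorm_diag_matrix_eq_1:
  fixes d :: "real ^ 'n"
  assumes "\<And>i. \<bar>d $ i\<bar> \<le> 1" and "d $ j = 1"
  shows "matrix_opnorm (diag_matrix d) = 1"
proof (rule antisym)
  show "matrix_opnorm (diag_matrix d) \<le> 1"
    unfolding matrix_opnorm_def
    by (rule onorm_bound) (use norm_diag_matrix_mult_le[OF assms(1)] in auto)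
  have fixed: "diag_matrix d *v axis j 1 = axis j 1"
    using assms(2) by (simp add: vec_eq_iff axis_def)
  show "1 \<le> matrix_opnorm (diag_matrix d)"
    unfolding matrix_opnorm_def
    using onorm[OF matrix_vector_mul_bounded_linear[of "diag_matrix d"], of "axis j 1"]
    by (simp add: fixed)
qed

lemma relu_vec_has_derivative:
  fixes z :: "real ^ 'n"
  assumes "\<And>j. z $ j \<noteq> 0"
  shows "(relu_vec has_derivative
    (\<lambda>v. diag_matrix (\<chi> j. deriv relu (z $ j)) *v v)) (at z)"
proof -
  have "((\<lambda>u. relu (u $ i)) has_derivative (\<lambda>v. deriv relu (z $ i) * v $ i)) (at z)" for i
  proof (rule has_derivative_compose[of "\<lambda>u. u $ i" "\<lambda>v. v $ i" _ _ relu])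
    show "((\<lambda>u. u $ i) has_derivative (\<lambda>v. v $ i)) (at z)"
      by (rule bounded_linear_imp_has_derivative) (rule bounded_linear_vec_nth)
    show "(relu has_derivative (*) (deriv relu (z $ i))) (at (z $ i))"
      using relu_has_real_derivative[OF assms] deriv_relu[OF assms]
      by (simp add: has_field_derivative_def)
  qed
  then have "((\<lambda>u. \<chi> i. relu (u $ i)) has_derivative
      (\<lambda>v. \<chi> i. deriv relu (z $ i) * v $ i)) (at z)"
    \<comment> \<open>The criterion tests inner products with basis vectors; these are the
      \<open>axis i 1\<close>, so the inner products are just the coordinates.\<close>
    by (subst has_derivative_componentwise_within) (auto simp: Basis_vec_def inner_axis)
  moreover have "(\<lambda>v. diag_matrix (\<chi> j. deriv relu (z $ j)) *v v) =
      (\<lambda>v. \<chi> i. deriv relu (z $ i) * v $ i)"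
    by (simp add: fun_eq_iff vec_eq_iff)
  ultimately show ?thesis
    by (simp add: relu_vec_def[abs_def])
qed

text \<open>Induction over the layers. The state equation is carried along with the derivative
  because it identifies the point at which the next layer has to be differentiated.\<close>

lemma rnn_state_has_contractive_derivative:
  fixes W :: "nat \<Rightarrow> real ^ 'n ^ 'n"
    and V :: "nat \<Rightarrow> real ^ 'm ^ 'n"
    and h z :: "nat \<Rightarrow> real ^ 'n"
  assumes "t \<le> T"
    and "\<And>k. k \<in> {t..<T} \<Longrightarrow> orthogonal_matrix (W k)"
    and "\<And>k. k \<in> {t..<T} \<Longrightarrow> z (Suc k) = W k *v h k + V k *v x (Suc k)"
    and "\<And>k. k \<in> {t..<T} \<Longrightarrow> h (Suc k) = relu_vec (z (Suc k))"
    and "\<And>k j. k \<in> {t..<T} \<Longrightarrow> z (Suc k) $ j \<noteq> 0"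
  shows "rnn_state W V x t (h t) T = h T \<and>
    (\<exists>L. ((\<lambda>u. rnn_state W V x t u T) has_derivative L) (at (h t)) \<and>
      (\<forall>v. norm (L v) \<le> norm v))"
  using assms
proof (induction T rule: dec_induct)
  case base
  \<comment> \<open>For \<open>t = 0\<close> this is the first clause of the recursion; for a
    successor \<open>t\<close> the test \<open>t \<le> k\<close> fails and the \<open>else\<close>
    branch applies.\<close>
  have "rnn_state W V x t u t = u" for u
    by (cases t) auto
  then show ?case
    by (auto intro!: exI[of _ "\<lambda>v. v"])
next
  case (step k)
  then obtain L where state: "rnn_state W V x t (h t) k = h k"
    and L: "((\<lambda>u. rnn_state W V x t u k) has_derivative L) (at (h t))"
    and contr: "\<And>v. norm (L v) \<le> norm v"
    by auto
  define A where "A = diag_matrix (\<chi> j. deriv relu (z (Suc k) $ j))"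
  have z: "z (Suc k) = W k *v h k + V k *v x (Suc k)"
    and h: "h (Suc k) = relu_vec (z (Suc k))"
    and nz: "\<And>j. z (Suc k) $ j \<noteq> 0"
    and orth: "orthogonal_matrix (W k)"
    using step by auto
  have "((\<lambda>u. W k *v rnn_state W V x t u k + V k *v x (Suc k)) has_derivative
      (\<lambda>v. W k *v L v)) (at (h t))"
    using has_derivative_add[OF
        bounded_linear.has_derivative[OF matrix_vector_mul_bounded_linear[of "W k"] L]
        has_derivative_const[of "V k *v x (Suc k)"]]
    by simp
  \<comment> \<open>By the state equation the point is \<open>z (Suc k)\<close>, which has no zero
    coordinate.\<close>
  moreover have "(relu_vec has_derivative (\<lambda>v. A *v v))
      (at (W k *v rnn_state W V x t (h t) k + V k *v x (Suc k)))"
    using relu_vec_has_derivative[OF nz] unfolding A_def state z .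
  ultimately have "((\<lambda>u. rnn_state W V x t u (Suc k)) has_derivative (\<lambda>v. A *v (W k *v L v)))
      (at (h t))"
    using has_derivative_compose[of "\<lambda>u. W k *v rnn_state W V x t u k + V k *v x (Suc k)"]
      step.hyps by simp
  moreover have "norm (A *v (W k *v L v)) \<le> norm v" for v
  proof -
    \<comment> \<open>The diagonal entries of \<open>A\<close> are 0 or 1, so \<open>A\<close> does
      not increase norms; the orthogonal \<open>W k\<close> preserves them.\<close>
    have "norm (A *v (W k *v L v)) \<le> norm (W k *v L v)"
      unfolding A_def by (rule norm_diag_matrix_mult_le) (simp add: deriv_relu[OF nz])
    also have "\<dots> = norm (L v)"
      using orth orthogonal_transformation_norm orthogonal_transformation_matrix
      by (metis matrix_of_matrix_vector_mul matrix_vector_mul_linear)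
    finally show ?thesis using contr[of v] by linarith
  qed
  ultimately show ?case
    using state z h step.hyps by auto
qed

text \<open>Riesz representation: the derivative is a linear functional, hence the inner product
  with a fixed vector. This makes the definite description in \<open>gradient\<close> denote the
  actual gradient.\<close>

lemma differentiable_imp_GDERIV_gradient:
  fixes f :: "real ^ 'n \<Rightarrow> real"
  assumes "f differentiable (at a)"
  shows "GDERIV f a :> gradient f a"
proof -
  obtain f' where f': "(f has_derivative f') (at a)"
    using assms by (auto simp: differentiable_def)
  then have "linear f'"
    by (rule has_derivative_linear)
  \<comment> \<open>The representing vector is the adjoint of \<open>f'\<close> applied to the
    scalar 1, since \<open>f' v\<close> equals \<open>f' v * 1\<close>.\<close>
  then have "f' = (\<lambda>v. v \<bullet> adjoint f' 1)"
    using adjoint_works[of f' _ 1] by (auto simp: fun_eq_iff)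
  then have "GDERIV f a :> adjoint f' 1"
    using f' by (simp add: gderiv_def)
  then show ?thesis
    using gradient_eqI by metis
qed

lemma norm_gradient_compose_contractive_le:
  fixes f :: "real ^ 'n \<Rightarrow> real" and g :: "real ^ 'm \<Rightarrow> real ^ 'n"
  assumes f: "f differentiable (at (g a))"
    and g: "(g has_derivative L) (at a)"
    and contr: "\<And>v. norm (L v) \<le> norm v"
  shows "norm (gradient (\<lambda>u. f (g u)) a) \<le> norm (gradient f (g a))"
proof -
  define p where "p = gradient (\<lambda>u. f (g u)) a"
  define q where "q = gradient f (g a)"
  have comp: "((\<lambda>u. f (g u)) has_derivative (\<lambda>v. L v \<bullet> q)) (at a)"
    using has_derivative_compose[OF g] differentiable_imp_GDERIV_gradient[OF f]
    by (auto simp: gderiv_def q_def)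
  then have "GDERIV (\<lambda>u. f (g u)) a :> p"
    unfolding p_def by (intro differentiable_imp_GDERIV_gradient) (auto simp: differentiable_def)
  \<comment> \<open>Uniqueness of the derivative of the composite identifies its two forms, by
    \<open>p\<close> and by \<open>L\<close> with \<open>q\<close>; they are evaluated in the
    direction \<open>p\<close>.\<close>
  then have "p \<bullet> p = L p \<bullet> q"
    using has_derivative_unique[OF comp] unfolding gderiv_def by metis
  also have "\<dots> \<le> norm (L p) * norm q"
    by (rule norm_cauchy_schwarz)
  also have "\<dots> \<le> norm p * norm q"
    by (intro mult_right_mono contr) simp
  finally have "norm p * norm p \<le> norm p * norm q"
    by (simp add: dot_square_norm power2_eq_square)
  then show ?thesis
    unfolding p_def[symmetric] q_def[symmetric]
    \<comment> \<open>The factor \<open>norm p\<close> cancels unless \<open>p = 0\<close>, where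
      the bound is trivial.\<close>
    by (cases "p = 0") auto
qed

theorem mainTheorem2:
  fixes t T :: nat
    and W :: "nat \<Rightarrow> real ^ 'n ^ 'n"
    and V :: "nat \<Rightarrow> real ^ 'm ^ 'n"
    and x :: "nat \<Rightarrow> real ^ 'm"
    and h z :: "nat \<Rightarrow> real ^ 'n"
    and D :: "nat \<Rightarrow> real ^ 'n ^ 'n"
    and C :: "real ^ 'n \<Rightarrow> real"
  assumes "t < T"
    and "\<And>k. k \<in> {t..<T} \<Longrightarrow> orthogonal_matrix (W k)"
    and "\<And>k. k \<in> {t..<T} \<Longrightarrow> z (Suc k) = W k *v h k + V k *v x (Suc k)"
    and "\<And>k. k \<in> {t..<T} \<Longrightarrow> h (Suc k) = relu_vec (z (Suc k))"
    and "\<And>k j. k \<in> {t..<T} \<Longrightarrow> z (Suc k) $ j \<noteq> 0"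
    and "\<And>k. k \<in> {t..<T} \<Longrightarrow> \<exists>j. z (Suc k) $ j > 0"
    and "C differentiable (at (h T))"
    and "\<And>k. k \<in> {t..<T} \<Longrightarrow> D (Suc k) = diag_matrix (\<chi> j. deriv relu (z (Suc k) $ j))"
  shows "(\<lambda>u. C (rnn_state W V x t u T)) differentiable (at (h t))
    \<and> norm (gradient (\<lambda>u. C (rnn_state W V x t u T)) (h t))
        \<le> norm (gradient C (h T)) * (\<Prod>k = t..<T. matrix_opnorm (D (Suc k)))
    \<and> norm (gradient C (h T)) * (\<Prod>k = t..<T. matrix_opnorm (D (Suc k)))
        = norm (gradient C (h T))"
proof -
  have state: "rnn_state W V x t (h t) T = h T"
    and "\<exists>L. ((\<lambda>u. rnn_state W V x t u T) has_derivative L) (at (h t)) \<and>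
      (\<forall>v. norm (L v) \<le> norm v)"
    using rnn_state_has_contractive_derivative[of t T W z h V x] assms(1-5) by auto
  then obtain L where L: "((\<lambda>u. rnn_state W V x t u T) has_derivative L) (at (h t))"
    and contr: "\<And>v. norm (L v) \<le> norm v"
    by blast
  have C: "C differentiable (at (rnn_state W V x t (h t) T))"
    using assms(7) by (simp add: state)
  \<comment> \<open>This guarantees that the gradient on the left of the bound is a genuine one and
    not an unspecified value.\<close>
  have "(\<lambda>u. C (rnn_state W V x t u T)) differentiable (at (h t))"
    using has_derivative_compose[OF L] C unfolding differentiable_def by blast
  moreover have "norm (gradient (\<lambda>u. C (rnn_state W V x t u T)) (h t)) \<le> norm (gradient C (h T))"
    using norm_gradient_compose_contractive_le[OF C L contr] by (simp add: state)
  \<comment> \<open>A positive coordinate of \<open>z (Suc k)\<close> supplies the diagonal entry 1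
    that keeps the norm from dropping to 0.\<close>
  moreover have "matrix_opnorm (D (Suc k)) = 1" if k: "k \<in> {t..<T}" for k
  proof -
    obtain j where "z (Suc k) $ j > 0"
      using assms(6)[OF k] by blast
    then show ?thesis
      unfolding assms(8)[OF k]
      by (intro matrix_opnorm_diag_matrix_eq_1[of _ j]) (simp_all add: deriv_relu[OF assms(5)[OF k]])
  qed
  then have "(\<Prod>k = t..<T. matrix_opnorm (D (Suc k))) = 1"
    by simp
  ultimately show ?thesis
    by simp
qed

end
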